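(* Let $n,k$ be positive integers with $n>2k$, let $G^{\ast}$ be a graph on vertex set $\{1,\ldots,k\}$, let $\breve{G}$ be a graph on $n-2k$ vertices rooted at a vertex $u$, let $y\in\{0,1\}^k$, and let $G=G(G^{\ast},\breve{G},y)$. Let $H=L(G^{\ast})+E_y$, where $L(G^{\ast})$ is the Laplacian matrix of $G^{\ast}$. Let $z\in\{0,1\}^k$, and set $D=\mathrm{spect}(H)$ and $F=\mathrm{spect}(H+2E_z)$. Then $D\subset \mathrm{Lspect}(G)$ and $$\mathrm{Lspect}(\mathcal{E}_z(G))=(\mathrm{Lspect}(G)\setminus D)\cup F,$$ where all spectra are multisets and the set operations are multiset operations. In particular, $G$ and $\mathcal{E}_z(G)$ have at least $n-k$ common Laplacian eigenvalues (counted with multiplicity).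
   Context: All graphs are simple and undirected. The Laplacian matrix of a graph is $L=D-A$ with $D$ the diagonal degree matrix and $A$ the adjacency matrix; $\mathrm{Lspect}(G)$ denotes the multiset of eigenvalues of $L(G)$, and $\mathrm{spect}(M)$ the multiset of eigenvalues of a square matrix $M$. Construction $G(G^{\ast},\breve{G},y)$: take two disjoint copies of $G^{\ast}$ and one copy of $\breve{G}$, and join the root $u$ of $\breve{G}$ to both copies of the vertex labeled $i$ of $G^{\ast}$ if and only if $y_i=1$; the result has $n$ vertices. For $y\in\{0,1\}^k$, $E_y=\sum_{i=1}^k y_i\, e_ie_i^T$ is the $k\times k$ diagonal matrix with diagonal $y$ (with $e_i$ the canonical basis vectors of $\mathbb{R}^k$). For $z\in\{0,1\}^k$, the operation $\mathcal{E}_z$ applied to $G=G(G^{\ast},\breve{G},y)$ adds, for every $i\in\{1,\ldots,k\}$ with $z_i=1$, an edge between the two copies of the vertex labeled $i$ of $G^{\ast}$. *)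

theory Defs
  imports
    "Graph_Theory.Graph_Theory"
    "Jordan_Normal_Form.Spectral_Radius"
begin

text \<open>
  A finite simple undirected graph is a \<open>pair_graph\<close>: a loop-free digraph with finitely many
  vertices and a symmetric set of arcs, an edge being represented by its two opposite arcs.
  The degree of a vertex is then its \<open>out_degree\<close>.

  Matrices of graphs are taken with respect to an enumeration \<open>vs\<close> of the vertices:
  row and column \<open>i\<close> (counted from 0) belong to the vertex \<open>vs ! i\<close>.
\<close>

definition adjacency_mat :: "'a list \<Rightarrow> 'a pair_pre_digraph \<Rightarrow> real mat" where
  "adjacency_mat vs G =
     mat (length vs) (length vs) (\<lambda>(i, j). if (vs ! i, vs ! j) \<in> parcs G then 1 else 0)"

definition degree_mat :: "'a list \<Rightarrow> 'a pair_pre_digraph \<Rightarrow> real mat" where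
  "degree_mat vs G = mat_diag (length vs) (\<lambda>i. real (out_degree (with_proj G) (vs ! i)))"

definition laplacian :: "'a list \<Rightarrow> 'a pair_pre_digraph \<Rightarrow> real mat" where
  "laplacian vs G = degree_mat vs G - adjacency_mat vs G"

text \<open>
  The multiset of all (complex) eigenvalues of a square matrix, each with its algebraic
  multiplicity.  For the symmetric matrices below all of them are real and the algebraic and
  geometric multiplicities agree.
\<close>

definition spect :: "real mat \<Rightarrow> complex multiset" where
  "spect M = proots (char_poly (map_mat complex_of_real M))"

lemma set_mset_spect:
  assumes "M \<in> carrier_mat n n"
  shows "set_mset (spect M) = spectrum (map_mat complex_of_real M)"
proof -
  have c: "map_mat complex_of_real M \<in> carrier_mat n n" using assms by simp
  have "char_poly (map_mat complex_of_real M) \<noteq> 0"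
    using degree_monic_char_poly[OF c] by auto
  then show ?thesis
    unfolding spect_def spectrum_root_char_poly[OF c] by simp
qed

text \<open>The choice of the enumeration is immaterial, see \<open>Lspect_eq\<close>.\<close>

definition Lspect :: "'a pair_pre_digraph \<Rightarrow> complex multiset" where
  "Lspect G = spect (laplacian (SOME vs. distinct vs \<and> set vs = pverts G) G)"

lemma laplacian_carrier: "laplacian vs G \<in> carrier_mat (length vs) (length vs)"
  by (simp add: laplacian_def degree_mat_def adjacency_mat_def minus_carrier_mat)

lemma laplacian_index:
  assumes "distinct vs" "i < length vs" "j < length vs"
  shows "laplacian vs G $$ (i, j) =
    (if vs ! i = vs ! j then real (out_degree (with_proj G) (vs ! i)) else 0)
    - (if (vs ! i, vs ! j) \<in> parcs G then 1 else 0)"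
  using assms
  by (auto simp: laplacian_def degree_mat_def adjacency_mat_def mat_diag_def nth_eq_iff_index_eq)

lemma similar_mat_enum:
  fixes f :: "'a \<Rightarrow> 'a \<Rightarrow> 'b :: comm_ring_1"
  assumes vs: "distinct vs" and ws: "distinct ws" and eq: "set vs = set ws"
  shows "similar_mat (mat (length vs) (length vs) (\<lambda>(i, j). f (vs ! i) (vs ! j)))
                     (mat (length ws) (length ws) (\<lambda>(i, j). f (ws ! i) (ws ! j)))"
proof -
  define n where "n = length vs"
  have lw: "length ws = n" unfolding n_def using vs ws eq by (metis distinct_card)
  define P :: "'a list \<Rightarrow> 'a list \<Rightarrow> 'b mat"
    where "P xs ys = mat n n (\<lambda>(i, j). if xs ! i = ys ! j then 1 else 0)" for xs ys
  have sum_list: "(\<Sum>l = 0..<n. g (xs ! l)) = sum g (set xs)"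
    if "distinct xs" "length xs = n" for g :: "'a \<Rightarrow> 'b" and xs
    using sum.reindex_bij_betw[OF bij_betw_nth[OF that(1), of "{0..<n}" "set xs"], of g] that
    by (simp add: atLeast0LessThan)
  have inv: "P xs ys * P ys xs = 1\<^sub>m n"
    if x: "distinct xs" "length xs = n" and y: "distinct ys" "length ys = n"
      and e: "set xs = set ys" for xs ys
  proof (rule eq_matI)
    fix i j assume ij: "i < dim_row (1\<^sub>m n :: 'b mat)" "j < dim_col (1\<^sub>m n :: 'b mat)"
    have "(P xs ys * P ys xs) $$ (i, j)
        = (\<Sum>l = 0..<n. (if xs ! i = ys ! l then 1 else 0) * (if ys ! l = xs ! j then 1 else 0))"
      using ij by (simp add: P_def scalar_prod_def)
    also have "\<dots> = (\<Sum>v\<in>set ys. (if xs ! i = v then 1 else 0) * (if v = xs ! j then 1 else 0))"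
      by (rule sum_list[OF y])
    also have "\<dots> = (\<Sum>v\<in>set ys. if xs ! i = v then (if v = xs ! j then 1 else 0) else 0)"
      by (rule sum.cong) auto
    also have "\<dots> = (if xs ! i = xs ! j then 1 else 0)"
      using ij x e by (auto simp: sum.delta)
    also have "\<dots> = 1\<^sub>m n $$ (i, j)"
      using ij x by (simp add: nth_eq_iff_index_eq)
    finally show "(P xs ys * P ys xs) $$ (i, j) = 1\<^sub>m n $$ (i, j)" .
  qed (simp_all add: P_def)
  define A where "A xs = mat n n (\<lambda>(i, j). f (xs ! i) (xs ! j))" for xs
  have AP: "A vs * P vs ws = P vs ws * A ws"
  proof (rule eq_matI)
    fix i j assume "i < dim_row (P vs ws * A ws)" "j < dim_col (P vs ws * A ws)"
    then have ij: "i < n" "j < n" by (simp_all add: P_def A_def)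
    have "(A vs * P vs ws) $$ (i, j)
        = (\<Sum>l = 0..<n. f (vs ! i) (vs ! l) * (if vs ! l = ws ! j then 1 else 0))"
      using ij by (simp add: P_def A_def scalar_prod_def)
    also have "\<dots> = (\<Sum>v\<in>set vs. f (vs ! i) v * (if v = ws ! j then 1 else 0))"
      by (rule sum_list) (use vs n_def in auto)
    also have "\<dots> = (\<Sum>v\<in>set vs. if v = ws ! j then f (vs ! i) v else 0)"
      by (rule sum.cong) auto
    also have "\<dots> = f (vs ! i) (ws ! j)"
      using ij eq lw by (auto simp: sum.delta)
    also have "\<dots> = (\<Sum>v\<in>set ws. if vs ! i = v then f v (ws ! j) else 0)"
      using ij eq n_def by (auto simp: sum.delta)
    also have "\<dots> = (\<Sum>v\<in>set ws. (if vs ! i = v then 1 else 0) * f v (ws ! j))"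
      by (rule sum.cong) auto
    also have "\<dots> = (\<Sum>l = 0..<n. (if vs ! i = ws ! l then 1 else 0) * f (ws ! l) (ws ! j))"
      by (rule sum_list[symmetric]) (use ws lw in auto)
    also have "\<dots> = (P vs ws * A ws) $$ (i, j)"
      using ij by (simp add: P_def A_def scalar_prod_def)
    finally show "(A vs * P vs ws) $$ (i, j) = (P vs ws * A ws) $$ (i, j)" .
  qed (simp_all add: P_def A_def)
  have carr: "A xs \<in> carrier_mat n n" "P xs ys \<in> carrier_mat n n" for xs ys
    by (simp_all add: A_def P_def)
  have PQ: "P vs ws * P ws vs = 1\<^sub>m n" "P ws vs * P vs ws = 1\<^sub>m n"
    by (rule inv[OF vs n_def[symmetric] ws lw eq], rule inv[OF ws lw vs n_def[symmetric] eq[symmetric]])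
  have "A vs = A vs * (P vs ws * P ws vs)"
    unfolding PQ(1) by (rule right_mult_one_mat[OF carr(1), symmetric])
  also have "\<dots> = P vs ws * A ws * P ws vs"
    unfolding AP[symmetric] using carr by (intro assoc_mult_mat[symmetric])
  finally have "similar_mat (A vs) (A ws)"
    by (rule similar_matI[OF _ PQ, rotated]) (simp add: carr)
  then show ?thesis unfolding A_def using lw n_def by simp
qed

lemma Lspect_eq:
  assumes "distinct vs" "set vs = pverts G"
  shows "Lspect G = spect (laplacian vs G)"
proof -
  define ws where "ws = (SOME vs. distinct vs \<and> set vs = pverts G)"
  have ws: "distinct ws \<and> set ws = pverts G"
    unfolding ws_def by (rule someI_ex) (use assms in blast)
  define f where "f a b = complex_of_real
    ((if a = b then real (out_degree (with_proj G) a) else 0)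
     - (if (a, b) \<in> parcs G then 1 else 0))" for a b
  have L: "map_mat complex_of_real (laplacian xs G)
      = mat (length xs) (length xs) (\<lambda>(i, j). f (xs ! i) (xs ! j))" if "distinct xs" for xs
    using laplacian_carrier[of xs G] that
    by (intro eq_matI) (auto simp: laplacian_index f_def)
  have "similar_mat (map_mat complex_of_real (laplacian ws G))
                    (map_mat complex_of_real (laplacian vs G))"
    unfolding L[OF conjunct1[OF ws]] L[OF assms(1)]
    by (rule similar_mat_enum) (use ws assms in auto)
  then show ?thesis
    unfolding Lspect_def ws_def[symmetric] spect_def by (simp add: char_poly_similar)
qed

text \<open>
  Two disjoint copies of \<open>Gs\<close>, tagged by a Boolean, together with \<open>Gb\<close>; the vertex \<open>u\<close> of \<open>Gb\<close> is
  joined to both copies of each vertex \<open>i\<close> of \<open>Gs\<close> with \<open>y i = 1\<close>.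
\<close>

definition two_copies ::
  "nat pair_pre_digraph \<Rightarrow> 'b pair_pre_digraph \<Rightarrow> 'b \<Rightarrow> (nat \<Rightarrow> real)
    \<Rightarrow> (bool \<times> nat + 'b) pair_pre_digraph" where
  "two_copies Gs Gb u y =
    \<lparr> pverts = {Inl (c, i) | c i. i \<in> pverts Gs} \<union> {Inr v | v. v \<in> pverts Gb},
      parcs = {(Inl (c, i), Inl (c, j)) | c i j. (i, j) \<in> parcs Gs}
        \<union> {(Inr v, Inr w) | v w. (v, w) \<in> parcs Gb}
        \<union> {(Inr u, Inl (c, i)) | c i. i \<in> pverts Gs \<and> y i = 1}
        \<union> {(Inl (c, i), Inr u) | c i. i \<in> pverts Gs \<and> y i = 1} \<rparr>"

definition join_copies ::
  "nat \<Rightarrow> (nat \<Rightarrow> real) \<Rightarrow> (bool \<times> nat + 'b) pair_pre_digraph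
    \<Rightarrow> (bool \<times> nat + 'b) pair_pre_digraph" where
  "join_copies k z G =
    G\<lparr> parcs := parcs G \<union> {(Inl (c, i), Inl (\<not> c, i)) | c i. i \<in> {1..k} \<and> z i = 1} \<rparr>"

text \<open>The labels \<open>1, \<dots>, k\<close> index \<open>y\<close>, so that row \<open>i\<close> of the matrix belongs to the label \<open>i + 1\<close>.\<close>

definition E_mat :: "nat \<Rightarrow> (nat \<Rightarrow> real) \<Rightarrow> real mat" where
  "E_mat k y = mat_diag k (\<lambda>i. y (i + 1))"

lemma pair_graphI:
  assumes "finite (pverts G)"
    and sub: "\<And>v w. (v, w) \<in> parcs G \<Longrightarrow> v \<in> pverts G \<and> w \<in> pverts G"
    and "\<And>v w. (v, w) \<in> parcs G \<Longrightarrow> (w, v) \<in> parcs G"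
    and "\<And>v. (v, v) \<notin> parcs G"
  shows "pair_graph G"
proof -
  have "parcs G \<subseteq> pverts G \<times> pverts G" using sub by auto
  then have "finite (parcs G)" using assms(1) finite_subset by blast
  then show ?thesis
    using assms by unfold_locales (auto simp: symmetric_def intro: symI)
qed

lemma pair_graphD:
  assumes "pair_graph G"
  shows "finite (pverts G)"
    and "(v, w) \<in> parcs G \<Longrightarrow> v \<in> pverts G"
    and "(v, w) \<in> parcs G \<Longrightarrow> w \<in> pverts G"
    and "(v, w) \<in> parcs G \<Longrightarrow> (w, v) \<in> parcs G"
    and "(v, v) \<notin> parcs G"
proof -
  interpret pair_graph G by fact
  show "finite (pverts G)" by (rule pair_finite_verts)
  show "(v, w) \<in> parcs G \<Longrightarrow> v \<in> pverts G" by (rule in_arcsD1)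
  show "(v, w) \<in> parcs G \<Longrightarrow> w \<in> pverts G" by (rule in_arcsD2)
  show "(v, w) \<in> parcs G \<Longrightarrow> (w, v) \<in> parcs G"
    using pair_sym_arcs unfolding symmetric_def by (auto dest: symD)
  show "(v, v) \<notin> parcs G" using pair_no_loops[of "(v, v)"] by auto
qed

lemma pverts_two_copies:
  "pverts (two_copies Gs Gb u y) = (UNIV \<times> pverts Gs) <+> pverts Gb"
  by (auto simp: two_copies_def)

lemma pair_graph_two_copies:
  assumes "pair_graph Gs" "pair_graph Gb" "u \<in> pverts Gb"
  shows "pair_graph (two_copies Gs Gb u y)"
proof (rule pair_graphI)
  show "finite (pverts (two_copies Gs Gb u y))"
    unfolding pverts_two_copies
    using pair_graphD(1)[OF assms(1)] pair_graphD(1)[OF assms(2)] by simp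
qed (use assms(3) pair_graphD(2-5)[OF assms(1)] pair_graphD(2-5)[OF assms(2)]
      in \<open>auto simp: two_copies_def\<close>)

lemma card_two_copies:
  assumes "pair_graph Gs" "pair_graph Gb"
  shows "card (pverts (two_copies Gs Gb u y)) = 2 * card (pverts Gs) + card (pverts Gb)"
  unfolding pverts_two_copies
  using pair_graphD(1)[OF assms(1)] pair_graphD(1)[OF assms(2)]
  by (simp add: card_Plus card_cartesian_product)

lemma pair_graph_join_copies:
  assumes "pair_graph (two_copies Gs Gb u y)" "pverts Gs = {1..k}"
  shows "pair_graph (join_copies k z (two_copies Gs Gb u y))"
proof (rule pair_graphI)
  show "finite (pverts (join_copies k z (two_copies Gs Gb u y)))"
    using pair_graphD(1)[OF assms(1)] by (simp add: join_copies_def)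
qed (use assms(2) pair_graphD(2-5)[OF assms(1)]
      in \<open>auto simp: join_copies_def pverts_two_copies\<close>)

end

theory Submission
  imports Defs
begin

text \<open>
  The vectors that are antisymmetric under exchanging the two copies span a subspace invariant
  under the Laplacian of \<open>\<E>\<^sub>z(G)\<close>, on which it acts as \<open>H + 2 E\<^sub>z\<close>; the induced map on the
  quotient does not depend on \<open>z\<close>, because there the added edges act as loops.  So the characteristic
  polynomial is that of \<open>H + 2 E\<^sub>z\<close> times a polynomial of degree \<open>n - k\<close> independent of \<open>z\<close>,
  and \<open>z = 0\<close> gives \<open>G\<close> itself.
\<close>

section \<open>Characteristic polynomials of block matrices with an invariant subspace\<close>

lemma char_poly_four_block_mat_lower_left_zero:
  fixes A :: "'a :: idom mat"
  assumes A: "A \<in> carrier_mat k k" and B: "B \<in> carrier_mat k m" and D: "D \<in> carrier_mat m m"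
  shows "char_poly (four_block_mat A B (0\<^sub>m m k) D) = char_poly A * char_poly D"
proof -
  let ?cm = "\<lambda>A. [:0, 1:] \<cdot>\<^sub>m 1\<^sub>m (dim_row A) + map_mat (\<lambda>a. [:- a:]) A"
  have "?cm (four_block_mat A B (0\<^sub>m m k) D)
      = four_block_mat (?cm A) (map_mat (\<lambda>a. [:- a:]) B) (0\<^sub>m m k) (?cm D)"
    using A B D by (intro eq_matI) (auto simp: one_poly_def)
  then show ?thesis
    unfolding char_poly_defs using A B D
    by (simp add: det_four_block_mat_lower_left_zero[of _ k _ m])
qed

text \<open>The assumption says that the columns of \<open>(1, -S)\<close> span an invariant subspace.\<close>

lemma char_poly_four_block_mat_invariant:
  fixes A :: "'a :: idom mat"
  assumes A: "A \<in> carrier_mat k k" and B: "B \<in> carrier_mat k m"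
    and C: "C \<in> carrier_mat m k" and D: "D \<in> carrier_mat m m" and S: "S \<in> carrier_mat m k"
    and inv: "C + S * A = (D + S * B) * S"
  shows "char_poly (four_block_mat A B C D) = char_poly (A - B * S) * char_poly (D + S * B)"
proof -
  let ?M = "four_block_mat A B C D"
  \<comment> \<open>Conjugating \<open>?M\<close> by \<open>?Q\<close>, whose inverse is
    \<open>?P\<close>, gives \<open>?N\<close>; \<open>inv\<close> is exactly the vanishing of the
    lower left block.\<close>
  let ?N = "four_block_mat (A - B * S) B (0\<^sub>m m k) (D + S * B)"
  let ?P = "four_block_mat (1\<^sub>m k) (0\<^sub>m k m) (- S) (1\<^sub>m m)"
  let ?Q = "four_block_mat (1\<^sub>m k) (0\<^sub>m k m) S (1\<^sub>m m)"
  note one = one_carrier_mat and zero = zero_carrier_mat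
  have S': "- S \<in> carrier_mat m k" using S by simp
  have SS: "- S + S = 0\<^sub>m m k" "S + - S = 0\<^sub>m m k"
    using carrier_matD[OF S] by (auto intro!: eq_matI)
  have SA: "S * A \<in> carrier_mat m k" and SB: "S * B \<in> carrier_mat m m"
    and BS: "B * S \<in> carrier_mat k k"
    using mult_carrier_mat[OF S A] mult_carrier_mat[OF S B] mult_carrier_mat[OF B S] .
  have N11: "A - B * S \<in> carrier_mat k k" and N22: "D + S * B \<in> carrier_mat m m"
    using minus_carrier_mat[OF BS] add_carrier_mat[OF SB] .
  note simps = left_mult_one_mat[OF S] left_mult_one_mat[OF S'] right_mult_one_mat[OF S]
    right_mult_one_mat[OF S'] left_mult_zero_mat[OF S] left_mult_zero_mat[OF S']
    right_mult_zero_mat[OF S] right_mult_zero_mat[OF S']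
    left_add_zero_mat[OF one] right_add_zero_mat[OF one]
    left_mult_one_mat[OF A] left_mult_one_mat[OF B] left_mult_one_mat[OF C]
    left_mult_one_mat[OF D] right_mult_one_mat[OF B] left_mult_zero_mat[OF C]
    left_mult_zero_mat[OF D] right_add_zero_mat[OF A] right_add_zero_mat[OF B]
    right_mult_one_mat[OF N11] right_mult_one_mat[OF N22] right_mult_zero_mat[OF N11]
    right_mult_zero_mat[OF N22] left_add_zero_mat[OF N22] left_add_zero_mat[OF B]
    left_mult_zero_mat[OF one] left_add_zero_mat[OF mult_carrier_mat[OF N22 S]]
  have PQ: "?P * ?Q = 1\<^sub>m (k + m)"
    unfolding mult_four_block_mat[OF one zero S' one one zero S one] by (simp add: simps SS)
  have QP: "?Q * ?P = 1\<^sub>m (k + m)"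
    unfolding mult_four_block_mat[OF one zero S one one zero S' one] by (simp add: simps SS)
  have car: "?M \<in> carrier_mat (k + m) (k + m)" "?N \<in> carrier_mat (k + m) (k + m)"
    "?P \<in> carrier_mat (k + m) (k + m)" "?Q \<in> carrier_mat (k + m) (k + m)"
    by (intro four_block_carrier_mat A D N11 N22 one)+
  have "?Q * ?M = four_block_mat A B ((D + S * B) * S) (D + S * B)"
    unfolding mult_four_block_mat[OF one zero S one A B C D] inv[symmetric]
    by (simp add: simps comm_add_mat[OF SA C] comm_add_mat[OF SB D])
  also have "\<dots> = ?N * ?Q"
  proof -
    have "A - B * S + B * S = A"
      using A B S by (intro eq_matI) auto
    then show ?thesis
      unfolding mult_four_block_mat[OF N11 B zero N22 one zero S one] by (simp add: simps)
  qed
  finally have QM: "?Q * ?M = ?N * ?Q" .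
  have "?M = ?P * ?Q * ?M"
    unfolding PQ by (rule left_mult_one_mat[OF car(1), symmetric])
  also have "\<dots> = ?P * (?N * ?Q)"
    unfolding QM[symmetric] by (rule assoc_mult_mat[OF car(3,4,1)])
  also have "\<dots> = ?P * ?N * ?Q"
    by (rule assoc_mult_mat[OF car(3,2,4), symmetric])
  finally have "similar_mat ?M ?N"
    by (rule similar_matI[OF _ PQ QP, rotated]) (use car in auto)
  then have "char_poly ?M = char_poly ?N"
    by (rule char_poly_similar)
  also have "\<dots> = char_poly (A - B * S) * char_poly (D + S * B)"
    by (rule char_poly_four_block_mat_lower_left_zero[OF N11 B N22])
  finally show ?thesis .
qed

text \<open>Indices below k stand for one copy, the next k for the other. The hypotheses make the
  span of the vectors e_j - e_(j+k) with j < k invariant. The first factor belongs to the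
  restriction to this span, the second to the quotient, where e_j and e_(j+k) are identified and
  their rows are therefore added.\<close>

lemma char_poly_two_copies:
  fixes f :: "nat \<Rightarrow> nat \<Rightarrow> 'a :: idom"
  assumes km: "k \<le> m"
    and off: "\<And>i j. i < k \<Longrightarrow> j < k \<Longrightarrow> f (i + k) j = f i (j + k)"
    and diag: "\<And>i j. i < k \<Longrightarrow> j < k \<Longrightarrow> f (i + k) (j + k) = f i j"
    and rest: "\<And>i j. k \<le> i \<Longrightarrow> i < m \<Longrightarrow> j < k \<Longrightarrow> f (i + k) (j + k) = f (i + k) j"
  shows "char_poly (mat (k + m) (k + m) (\<lambda>(i, j). f i j))
    = char_poly (mat k k (\<lambda>(i, j). f i j - f i (j + k)))
      * char_poly (mat m m (\<lambda>(i, j). f (i + k) (j + k) + (if i < k then f i (j + k) else 0)))"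
proof -
  define A where "A = mat k k (\<lambda>(i, j). f i j)"
  define B where "B = mat k m (\<lambda>(i, j). f i (j + k))"
  define C where "C = mat m k (\<lambda>(i, j). f (i + k) j)"
  define D where "D = mat m m (\<lambda>(i, j). f (i + k) (j + k))"
  \<comment> \<open>The identity on top of zero rows, so that the columns of (1, -S) are the vectors
    e_j - e_(j+k).\<close>
  define S where "S = mat m k (\<lambda>(i, j). if i = j then 1 else 0 :: 'a)"
  have XS: "(X * S) $$ (i, j) = X $$ (i, j)"
    if "X \<in> carrier_mat r m" "i < r" "j < k" for X r i j
  proof -
    have "(X * S) $$ (i, j) = (\<Sum>l = 0..<m. X $$ (i, l) * (if l = j then 1 else 0))"
      using that by (simp add: S_def scalar_prod_def)
    also have "\<dots> = (\<Sum>l = 0..<m. if l = j then X $$ (i, l) else 0)"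
      by (rule sum.cong) auto
    finally show ?thesis using that km by simp
  qed
  have SX: "(S * X) $$ (i, j) = (if i < k then X $$ (i, j) else 0)"
    if "X \<in> carrier_mat k r" "i < m" "j < r" for X r i j
  proof -
    have "(S * X) $$ (i, j) = (\<Sum>l = 0..<k. (if i = l then 1 else 0) * X $$ (l, j))"
      using that by (simp add: S_def scalar_prod_def)
    also have "\<dots> = (\<Sum>l = 0..<k. if i = l then X $$ (l, j) else 0)"
      by (rule sum.cong) auto
    finally show ?thesis using that by simp
  qed
  have car: "A \<in> carrier_mat k k" "B \<in> carrier_mat k m" "C \<in> carrier_mat m k"
    "D \<in> carrier_mat m m" "S \<in> carrier_mat m k"
    by (simp_all add: A_def B_def C_def D_def S_def)
  have M: "mat (k + m) (k + m) (\<lambda>(i, j). f i j) = four_block_mat A B C D"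
    by (rule eq_matI) (auto simp: A_def B_def C_def D_def)
  have AB: "A - B * S = mat k k (\<lambda>(i, j). f i j - f i (j + k))"
    using car km by (intro eq_matI) (auto simp: XS[OF car(2)] simp del: index_mult_mat(1), auto simp: A_def B_def)
  have DB: "D + S * B = mat m m (\<lambda>(i, j). f (i + k) (j + k) + (if i < k then f i (j + k) else 0))"
    using car km by (intro eq_matI) (auto simp: SX[OF car(2)] simp del: index_mult_mat(1), auto simp: D_def B_def)
  have "C + S * A = (D + S * B) * S"
  proof (rule eq_matI)
    fix i j assume "i < dim_row ((D + S * B) * S)" "j < dim_col ((D + S * B) * S)"
    then have ij: "i < m" "j < k" using car by auto
    have "((D + S * B) * S) $$ (i, j) = (D + S * B) $$ (i, j)"
      using car ij by (intro XS[of _ m]) auto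
    moreover have "(C + S * A) $$ (i, j) = f (i + k) j + (if i < k then f i j else 0)"
      using car ij by (simp add: SX[OF car(1)] del: index_mult_mat(1)) (simp add: C_def A_def)
    \<comment> \<open>For i < k, \<open>off\<close> and \<open>diag\<close> match the two summands
      crosswise; for i >= k there is a single summand, matched by \<open>rest\<close>.\<close>
    ultimately show "(C + S * A) $$ (i, j) = ((D + S * B) * S) $$ (i, j)"
      using ij km off[of i j] diag[of i j] rest[of i j] by (simp add: DB)
  qed (use car in auto)
  from char_poly_four_block_mat_invariant[OF car this] show ?thesis
    unfolding M AB DB .
qed

section \<open>Spectra as multisets of complex roots\<close>

text \<open>The real factorization carries over to the complex numbers. Characteristic polynomials
  are monic, hence nonzero, and the root multisets of nonzero factors add up.\<close>

lemma spect_eq_add: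
  assumes "M \<in> carrier_mat r r" "A \<in> carrier_mat k k" "N \<in> carrier_mat m m"
    and "char_poly M = char_poly A * char_poly N"
  shows "spect M = spect A + spect N"
proof -
  interpret of_real_poly: map_poly_comm_semiring_hom complex_of_real ..
  have nz: "char_poly (map_mat complex_of_real X) \<noteq> 0" if "X \<in> carrier_mat d d" for X d
    using degree_monic_char_poly[of "map_mat complex_of_real X" d] that by auto
  have "char_poly (map_mat complex_of_real M)
      = char_poly (map_mat complex_of_real A) * char_poly (map_mat complex_of_real N)"
    unfolding of_real_hom.char_poly_hom[OF assms(1)] of_real_hom.char_poly_hom[OF assms(2)]
      of_real_hom.char_poly_hom[OF assms(3)] assms(4)
    by (rule of_real_poly.hom_mult)
  then show ?thesis
    unfolding spect_def using nz assms(2,3) by (simp add: proots_mult)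
qed

lemma size_spect:
  assumes "M \<in> carrier_mat m m"
  shows "size (spect M) = m"
  using degree_monic_char_poly[of "map_mat complex_of_real M" m] assms
  by (simp add: spect_def size_proots_complex)

section \<open>Arcs and degrees in the constructed graphs\<close>

lemma out_degree_with_proj:
  "out_degree (with_proj G) v = card {w. (v, w) \<in> parcs G}"
proof -
  have "out_arcs (with_proj G) v = Pair v ` {w. (v, w) \<in> parcs G}"
    by (auto simp: out_arcs_def)
  then show ?thesis
    by (simp add: out_degree_def card_image inj_on_def)
qed

lemma join_copies_0: "join_copies k (\<lambda>_. 0) G = G"
  by (simp add: join_copies_def)

lemma parcs_join_two_copies:
  assumes "pverts Gs = {1..k}"
  shows "(Inl (c, i), Inl (d, j)) \<in> parcs (join_copies k z (two_copies Gs Gb u y)) \<longleftrightarrow>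
      c = d \<and> (i, j) \<in> parcs Gs \<or> c \<noteq> d \<and> i = j \<and> i \<in> {1..k} \<and> z i = 1"
    and "(Inl (c, i), Inr v) \<in> parcs (join_copies k z (two_copies Gs Gb u y)) \<longleftrightarrow>
      v = u \<and> i \<in> {1..k} \<and> y i = 1"
    and "(Inr v, Inl (c, i)) \<in> parcs (join_copies k z (two_copies Gs Gb u y)) \<longleftrightarrow>
      v = u \<and> i \<in> {1..k} \<and> y i = 1"
    and "(Inr v, Inr w) \<in> parcs (join_copies k z (two_copies Gs Gb u y)) \<longleftrightarrow> (v, w) \<in> parcs Gb"
  using assms by (auto simp: join_copies_def two_copies_def)

lemma out_degree_join_two_copies_Inl:
  assumes Gs: "pair_graph Gs" "pverts Gs = {1..k}" and i: "i \<in> {1..k}"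
  shows "out_degree (with_proj (join_copies k z (two_copies Gs Gb u y))) (Inl (c, i)) =
    out_degree (with_proj Gs) i + of_bool (y i = 1) + of_bool (z i = 1)"
proof -
  \<comment> \<open>The neighbours split into those in the same copy, possibly the root, and
    possibly the twin in the other copy; the three sets are disjoint.\<close>
  let ?N = "(\<lambda>j. Inl (c, j)) ` {j. (i, j) \<in> parcs Gs}"
  let ?Y = "if y i = 1 then {Inr u} else {}"
  let ?Z = "if z i = 1 then {Inl (\<not> c, i)} else {}"
  have "{w. (Inl (c, i), w) \<in> parcs (join_copies k z (two_copies Gs Gb u y))} = ?N \<union> ?Y \<union> ?Z"
  proof (rule Set.set_eqI)
    fix w
    show "w \<in> {w. (Inl (c, i), w) \<in> parcs (join_copies k z (two_copies Gs Gb u y))}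
        \<longleftrightarrow> w \<in> ?N \<union> ?Y \<union> ?Z"
      using i by (cases w) (auto simp: parcs_join_two_copies[OF Gs(2)])
  qed
  moreover have "finite {j. (i, j) \<in> parcs Gs}"
    by (rule finite_subset[OF _ pair_graphD(1)[OF Gs(1)]]) (auto dest: pair_graphD(3)[OF Gs(1)])
  then have "card (?N \<union> ?Y \<union> ?Z)
      = card {j. (i, j) \<in> parcs Gs} + of_bool (y i = 1) + of_bool (z i = 1)"
    by (subst card_Un_disjoint; (subst card_Un_disjoint)?) (auto simp: card_image inj_on_def)
  ultimately show ?thesis
    by (simp add: out_degree_with_proj)
qed

text \<open>The added edges join only \<open>Inl\<close> vertices, so degrees in the rooted graph do
  not depend on z.\<close>

lemma out_degree_join_two_copies_Inr:
  "out_degree (with_proj (join_copies k z (two_copies Gs Gb u y))) (Inr v) =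
    out_degree (with_proj (two_copies Gs Gb u y)) (Inr v)"
proof -
  have "{w. (Inr v, w) \<in> parcs (join_copies k z (two_copies Gs Gb u y))}
      = {w. (Inr v, w) \<in> parcs (two_copies Gs Gb u y)}"
    by (auto simp: join_copies_def)
  then show ?thesis by (simp add: out_degree_with_proj)
qed

section \<open>Block form of the Laplacian\<close>

text \<open>The order of the quantifiers matters: one matrix N serves every z, so the graphs for
  different z share all of \<open>spect N\<close>.\<close>

lemma Lspect_join_two_copies:
  assumes Gs: "pair_graph Gs" "pverts Gs = {1..k}" and Gb: "pair_graph Gb"
    and y: "y \<in> {1..k} \<rightarrow> {0, 1}"
  shows "\<exists>N \<in> carrier_mat (k + card (pverts Gb)) (k + card (pverts Gb)).
    \<forall>z \<in> {1..k} \<rightarrow> {0, 1}. Lspect (join_copies k z (two_copies Gs Gb u y))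
      = spect (laplacian [1..<k + 1] Gs + E_mat k y + 2 \<cdot>\<^sub>m E_mat k z) + spect N"
proof -
  obtain bs where bs: "distinct bs" "set bs = pverts Gb"
    using finite_distinct_list[OF pair_graphD(1)[OF Gb]] by blast
  \<comment> \<open>Enumeration in the order required by \<open>char_poly_two_copies\<close>; for i
    < k, positions i and i + k hold the two vertices with label i + 1.\<close>
  define vs where "vs = map (\<lambda>i. Inl (True, i)) [1..<k + 1]
    @ map (\<lambda>i. Inl (False, i)) [1..<k + 1] @ map Inr bs"
  define m where "m = k + card (pverts Gb)"
  have len_bs: "length bs = card (pverts Gb)" using bs distinct_card by metis
  have len: "length vs = k + m" using len_bs by (simp add: vs_def m_def)
  have vs1: "vs ! i = Inl (True, i + 1)" if "i < k" for i
    using that by (simp add: vs_def m_def nth_append del: upt_Suc)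
  have vs2: "vs ! (i + k) = Inl (False, i + 1)" if "i < k" for i
    using that by (simp add: vs_def m_def nth_append del: upt_Suc)
  have vs3: "vs ! (i + k) = Inr (bs ! (i - k))" if "k \<le> i" "i < m" for i
    using that len_bs by (simp add: vs_def m_def nth_append del: upt_Suc)
  have dist: "distinct vs" using bs by (auto simp: vs_def distinct_map inj_on_def)
  have set_vs: "set vs = pverts (join_copies k z (two_copies Gs Gb u y))" for z
    using bs Gs(2) by (fastforce simp: vs_def join_copies_def pverts_two_copies)
  define f where "f z i j = laplacian vs (join_copies k z (two_copies Gs Gb u y)) $$ (i, j)" for z i j
  define N where "N z = mat m m (\<lambda>(i, j). f z (i + k) (j + k) + (if i < k then f z i (j + k) else 0))" for z
  let ?d = "\<lambda>i. real (out_degree (with_proj Gs) (i + 1))"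
  let ?a = "\<lambda>i j. if (i + 1, j + 1) \<in> parcs Gs then 1 else 0 :: real"
  have f_eq: "f z i j = (if vs ! i = vs ! j
        then real (out_degree (with_proj (join_copies k z (two_copies Gs Gb u y))) (vs ! i)) else 0)
      - (if (vs ! i, vs ! j) \<in> parcs (join_copies k z (two_copies Gs Gb u y)) then 1 else 0)"
    if "i < k + m" "j < k + m" for z i j
    unfolding f_def using laplacian_index[OF dist] that len by simp
  have km: "k \<le> m" by (simp add: m_def)
  note f_simps = f_eq vs1 vs2 vs3 parcs_join_two_copies[OF Gs(2)]
    out_degree_join_two_copies_Inl[OF Gs] out_degree_join_two_copies_Inr
  \<comment> \<open>The digits in these names give the row and column blocks: 1 and 2 for the
    copies, 3 for the rooted graph.\<close>
  have f11: "f z i j = (if i = j then ?d i + of_bool (y (i + 1) = 1) + of_bool (z (i + 1) = 1) else 0) - ?a i j"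
    and f12: "f z i (j + k) = - of_bool (i = j \<and> z (i + 1) = 1)"
    and f21: "f z (i + k) j = f z i (j + k)"
    and f22: "f z (i + k) (j + k) = f z i j"
    if "i < k" "j < k" for z i j
    using that km by (auto simp: f_simps)
  have f31: "f z (i + k) j = - of_bool (bs ! (i - k) = u \<and> y (j + 1) = 1)"
    and f32: "f z (i + k) (j + k) = f z (i + k) j"
    and f13: "f z j (i + k) = f z (i + k) j"
    and f23: "f z (j + k) (i + k) = f z (i + k) j"
    if "k \<le> i" "i < m" "j < k" for z i j
    using that km by (auto simp: f_simps)
  have f33: "f z (i + k) (j + k) = f (\<lambda>_. 0) (i + k) (j + k)"
    if "k \<le> i" "i < m" "k \<le> j" "j < m" for z i j
    using that by (simp add: f_simps)
  \<comment> \<open>On the diagonal, for i < k, the extra degree of a joined vertex cancels against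
    the entry -1 between the twins: in the quotient the new edge is a loop. No other entry of the
    sum involves z.\<close>
  have N_indep: "N z = N (\<lambda>_. 0)" for z
  proof (rule eq_matI)
    fix i j assume "i < dim_row (N (\<lambda>_. 0))" "j < dim_col (N (\<lambda>_. 0))"
    then have ij: "i < m" "j < m" by (simp_all add: N_def)
    then show "N z $$ (i, j) = N (\<lambda>_. 0) $$ (i, j)"
      by (cases "i < k"; cases "j < k") (auto simp: N_def f11 f12 f22 f31 f32 f13 f23 f33[of i j z])
  qed (simp_all add: N_def)
  have "Lspect (join_copies k z (two_copies Gs Gb u y))
      = spect (laplacian [1..<k + 1] Gs + E_mat k y + 2 \<cdot>\<^sub>m E_mat k z) + spect (N (\<lambda>_. 0))"
    if z: "z \<in> {1..k} \<rightarrow> {0, 1}" for z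
  proof -
    let ?L = "laplacian vs (join_copies k z (two_copies Gs Gb u y))"
    let ?A = "laplacian [1..<k + 1] Gs + E_mat k y + 2 \<cdot>\<^sub>m E_mat k z"
    have L_car: "?L \<in> carrier_mat (k + m) (k + m)"
      using laplacian_carrier[of vs] len by metis
    have L: "?L = mat (k + m) (k + m) (\<lambda>(i, j). f z i j)"
      using L_car by (intro eq_matI) (auto simp: f_def)
    \<comment> \<open>The graphs only test whether a value equals 1, whereas \<open>E_mat\<close>
      contains the value itself; on {0, 1} both agree.\<close>
    have yz: "y (i + 1) = of_bool (y (i + 1) = 1)" "z (i + 1) = of_bool (z (i + 1) = 1)"
      if "i < k" for i
      using that Pi_mem[OF y, of "i + 1"] Pi_mem[OF z, of "i + 1"] by auto
    have A_car: "?A \<in> carrier_mat k k"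
      by (simp add: E_mat_def mat_diag_def)
    \<comment> \<open>The coefficient 2 arises here: an edge between twins adds 1 to the degree, and
      subtracting its entry -1 adds 1 again.\<close>
    have A: "mat k k (\<lambda>(i, j). f z i j - f z i (j + k)) = ?A"
    proof (rule eq_matI)
      fix i j assume "i < dim_row ?A" "j < dim_col ?A"
      then have ij: "i < k" "j < k" using A_car by auto
      have "laplacian [1..<k + 1] Gs $$ (i, j) = (if i = j then ?d i else 0) - ?a i j"
        using ij laplacian_index[of "[1..<k + 1]" i j Gs] by (simp add: nth_upt del: upt_Suc)
      then show "mat k k (\<lambda>(i, j). f z i j - f z i (j + k)) $$ (i, j) = ?A $$ (i, j)"
        using ij yz[OF ij(1)] by (auto simp: f11 f12 E_mat_def mat_diag_def)
    qed (use A_car in auto)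
    have "char_poly ?L = char_poly ?A * char_poly (N z)"
      unfolding L N_def A[symmetric] by (rule char_poly_two_copies) (use km in \<open>simp_all add: f21 f22 f32\<close>)
    then have "spect ?L = spect ?A + spect (N z)"
      by (intro spect_eq_add[OF L_car A_car, of _ m]) (simp_all add: N_def)
    then show ?thesis
      unfolding Lspect_eq[OF dist set_vs] N_indep[of z] .
  qed
  moreover have "N (\<lambda>_. 0) \<in> carrier_mat m m" by (simp add: N_def)
  ultimately show ?thesis unfolding m_def by blast
qed

theorem theorem1p1:
  fixes n k :: nat
    and Gs :: "nat pair_pre_digraph"
    and Gb :: "'b pair_pre_digraph"
    and u :: 'b
    and y z :: "nat \<Rightarrow> real"
  assumes "0 < k" and "2 * k < n"
    and "pair_graph Gs" and "pverts Gs = {1..k}"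
    and "pair_graph Gb" and "card (pverts Gb) = n - 2 * k" and "u \<in> pverts Gb"
    and "y \<in> {1..k} \<rightarrow> {0, 1}" and "z \<in> {1..k} \<rightarrow> {0, 1}"
  defines "G \<equiv> two_copies Gs Gb u y"
    and "H \<equiv> laplacian [1..<k + 1] Gs + E_mat k y"
  defines "D \<equiv> spect H"
    and "F \<equiv> spect (H + 2 \<cdot>\<^sub>m E_mat k z)"
  shows "D \<subseteq># Lspect G
    \<and> Lspect (join_copies k z G) = (Lspect G - D) + F
    \<and> n - k \<le> size (Lspect G \<inter># Lspect (join_copies k z G))"
proof -
  define m where "m = k + card (pverts Gb)"
  obtain N where N: "N \<in> carrier_mat m m"
    and spec: "\<And>z. z \<in> {1..k} \<rightarrow> {0, 1} \<Longrightarrow>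
      Lspect (join_copies k z G) = spect (H + 2 \<cdot>\<^sub>m E_mat k z) + spect N"
    unfolding G_def H_def m_def using Lspect_join_two_copies[OF assms(3-5,8)] by blast
  have "H + 2 \<cdot>\<^sub>m E_mat k (\<lambda>_. 0) = H"
    by (rule eq_matI) (auto simp: H_def E_mat_def mat_diag_def)
  then have G: "Lspect G = D + spect N"
    using spec[of "\<lambda>_. 0"] by (simp add: join_copies_0 D_def)
  have J: "Lspect (join_copies k z G) = F + spect N"
    using spec[OF assms(9)] by (simp add: F_def)
  have "spect N \<subseteq># Lspect G \<inter># Lspect (join_copies k z G)"
    unfolding G J by simp
  \<comment> \<open>The common part \<open>spect N\<close> has k + (n - 2k) = n - k
    elements.\<close>
  from size_mset_mono[OF this]
  have "n - k \<le> size (Lspect G \<inter># Lspect (join_copies k z G))"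
    using assms(2,6) by (simp add: size_spect[OF N] m_def)
  \<comment> \<open>As D is a summand of \<open>Lspect G\<close>, removing it leaves exactly
    \<open>spect N\<close>.\<close>
  then show ?thesis
    unfolding J by (simp add: G)
qed

end
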